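(* Let $k\ge1$ be an integer. Suppose $f:\mathbb{R}^n\to\mathbb{R}$ is $D^k$ near $\overline x\in\mathbb{R}^n$ and that for all $x\in[f=f(\overline x)]$ near $\overline x$, $f^{(i)}(x)=0$ for all $i\in\{1,\dots,k-1\}$. (i) If $\overline x$ is flat, then $\overline x$ is a local minimum of $\|f^{(k)}\|+\delta_{[f=f(\overline x)]}$. (ii) If $\overline x$ is a strict local minimum of $\|f^{(k)}\|+\delta_{[f=f(\overline x)]}$, then $\overline x$ is strictly flat.
   Context: $f$ is $D^1$ at a point if it is Fréchet differentiable there; inductively, $f$ is $D^k$ at a point if it is $D^{k-1}$ near that point and $f^{(k-1)}$ is Fréchet differentiable at that point. "$D^k$ near $\overline x$" means $D^k$ at every point of a neighborhood of $\overline x$. The norm is $\|f^{(k)}(x)\|=\sup_{|v|=1}|f^{(k)}(x)(v,\dots,v)|$. $[f=\alpha]=\{x:f(x)=\alpha\}$ and $\delta_S$ is the indicator function ($0$ on $S$, $\infty$ off $S$). Flatness: let $\mathring f(x,r)=\sup_{y\in\overline B_r(x)}|f(y)-f(x)|$ with $\overline B_r(x)$ the closed Euclidean ball. Write $x\preceq y$ iff there exists $\overline r>0$ such that $\mathring f(x,r)\le\mathring f(y,r)$ for all $r\in(0,\overline r]$, and $x\prec y$ iff $x\preceq y$ and not $y\preceq x$. A point $\overline x$ is flat (resp. strictly flat) if there is a neighborhood $U$ of $\overline x$ in $[f=f(\overline x)]$ such that $\overline x\preceq x$ (resp. $\overline x\prec x$) for all $x\in U\setminus\{\overline x\}$. 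*)

theory Defs
  imports "HOL-Analysis.Analysis"
begin

section \<open>Bounded multilinear forms\<close>

text \<open>
  The \<open>k\<close>-th derivative of \<open>f :: 'a \<Rightarrow> real\<close> at a point is a \<open>k\<close>-linear form on \<open>'a\<close>. Since \<open>k\<close>
  varies, the forms of all degrees are put into one normed space: an element is a function \<open>T\<close> on
  lists whose restriction to the lists of length \<open>k\<close> is a \<open>k\<close>-linear form, for each \<open>k\<close>, with
  operator norms bounded uniformly in \<open>k\<close>. The norm is the supremum of the operator norms. A form of
  degree \<open>k\<close> is an element that vanishes on lists of length other than \<open>k\<close>; on these the
  norm is the usual operator norm.
\<close>

definition multilinear :: "('a::real_normed_vector list \<Rightarrow> real) \<Rightarrow> bool" where
  "multilinear T \<longleftrightarrow> (\<forall>us ws. linear (\<lambda>v. T (us @ v # ws)))"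

definition unit_lists :: "'a::real_normed_vector list set" where
  "unit_lists = {vs. \<forall>v\<in>set vs. norm v \<le> 1}"

typedef (overloaded) ('a::real_normed_vector) multiform =
  "{T :: 'a list \<Rightarrow> real. multilinear T \<and> (\<exists>B. \<forall>vs\<in>unit_lists. \<bar>T vs\<bar> \<le> B)}"
  morphisms form_apply Multiform
  by (rule exI[of _ "\<lambda>_. 0"]) (auto simp: multilinear_def intro!: linear_zero exI[of _ 0])

setup_lifting type_definition_multiform

lemma multilinear_normalize:
  assumes "multilinear T"
  shows "T (us @ vs) = prod_list (map norm vs) * T (us @ map sgn vs)"
proof (induction vs arbitrary: us)
  case (Cons v vs)
  have "T (us @ v # vs) = T ((us @ [v]) @ vs)" by simp
  also have "\<dots> = prod_list (map norm vs) * T ((us @ [v]) @ map sgn vs)"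
    by (rule Cons.IH)
  also have "T ((us @ [v]) @ map sgn vs) = T (us @ (norm v *\<^sub>R sgn v) # map sgn vs)"
    by (cases "v = 0") (simp_all add: sgn_div_norm)
  also have "\<dots> = norm v * T (us @ sgn v # map sgn vs)"
  proof -
    have "linear (\<lambda>w. T (us @ w # map sgn vs))"
      using assms by (simp add: multilinear_def)
    from linear_scale[OF this, of "norm v" "sgn v"] show ?thesis by simp
  qed
  finally show ?case by (simp add: mult_ac)
qed simp

lemma map_sgn_unit_lists: "map sgn vs \<in> unit_lists"
  by (auto simp: unit_lists_def norm_sgn)

lemma unit_lists_Nil [simp]: "[] \<in> unit_lists"
  by (simp add: unit_lists_def)

lemma multilinear_eq_0:
  assumes "multilinear T" "\<And>vs. vs \<in> unit_lists \<Longrightarrow> T vs = 0"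
  shows "T = (\<lambda>_. 0)"
proof
  fix vs show "T vs = 0"
    using multilinear_normalize[OF assms(1), of "[]" vs] assms(2)[OF map_sgn_unit_lists]
    by simp
qed

instantiation multiform :: (real_normed_vector) real_normed_vector
begin

lift_definition norm_multiform :: "'a multiform \<Rightarrow> real"
  is "\<lambda>T. SUP vs\<in>unit_lists. \<bar>T vs\<bar>" .

lift_definition zero_multiform :: "'a multiform" is "\<lambda>_. 0"
  by (auto simp: multilinear_def intro!: linear_zero exI[of _ 0])

lift_definition plus_multiform :: "'a multiform \<Rightarrow> 'a multiform \<Rightarrow> 'a multiform"
  is "\<lambda>S T vs. S vs + T vs"
proof (elim conjE exE, intro conjI)
  fix S T :: "'a list \<Rightarrow> real" and B C
  assume "multilinear S" "multilinear T"
  then show "multilinear (\<lambda>vs. S vs + T vs)"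
    by (simp add: multilinear_def linear_compose_add)
  assume "\<forall>vs\<in>unit_lists. \<bar>S vs\<bar> \<le> B" "\<forall>vs\<in>unit_lists. \<bar>T vs\<bar> \<le> C"
  then show "\<exists>B. \<forall>vs\<in>unit_lists. \<bar>S vs + T vs\<bar> \<le> B"
    by (intro exI[of _ "B + C"] ballI order.trans[OF abs_triangle_ineq] add_mono) auto
qed

lift_definition scaleR_multiform :: "real \<Rightarrow> 'a multiform \<Rightarrow> 'a multiform"
  is "\<lambda>c T vs. c * T vs"
proof (elim conjE exE, intro conjI)
  fix c and T :: "'a list \<Rightarrow> real" and B
  assume "multilinear T"
  then show "multilinear (\<lambda>vs. c * T vs)"
    unfolding multilinear_def
    by (simp add: linear_iff distrib_left)
  assume "\<forall>vs\<in>unit_lists. \<bar>T vs\<bar> \<le> B"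
  then show "\<exists>B. \<forall>vs\<in>unit_lists. \<bar>c * T vs\<bar> \<le> B"
    by (intro exI[of _ "\<bar>c\<bar> * B"] ballI) (simp add: abs_mult mult_left_mono)
qed

definition uminus_multiform :: "'a multiform \<Rightarrow> 'a multiform" where
  "uminus_multiform T = (-1) *\<^sub>R T"

definition minus_multiform :: "'a multiform \<Rightarrow> 'a multiform \<Rightarrow> 'a multiform" where
  "minus_multiform S T = S + - T"

definition dist_multiform :: "'a multiform \<Rightarrow> 'a multiform \<Rightarrow> real" where
  "dist_multiform S T = norm (S - T)"

definition uniformity_multiform :: "('a multiform \<times> 'a multiform) filter" where
  "uniformity_multiform = (INF e\<in>{0<..}. principal {(S, T). dist S T < e})"

definition open_multiform :: "'a multiform set \<Rightarrow> bool" where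
  "open_multiform U = (\<forall>S\<in>U. \<forall>\<^sub>F (S', T) in uniformity. S' = S \<longrightarrow> T \<in> U)"

definition sgn_multiform :: "'a multiform \<Rightarrow> 'a multiform" where
  "sgn_multiform T = inverse (norm T) *\<^sub>R T"

instance
proof
  fix S T R :: "'a multiform" and a b :: real
  have bound: "\<bar>form_apply T vs\<bar> \<le> norm T" if "vs \<in> unit_lists" for vs and T :: "'a multiform"
  proof -
    have "\<exists>B. \<forall>vs\<in>unit_lists. \<bar>form_apply T vs\<bar> \<le> B"
      using form_apply[of T] by auto
    then have "bdd_above ((\<lambda>vs. \<bar>form_apply T vs\<bar>) ` unit_lists)"
      by (auto intro: bdd_aboveI2)
    then show ?thesis unfolding norm_multiform.rep_eq using that by (intro cSUP_upper)
  qed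
  have least: "norm T \<le> B" if "\<And>vs. vs \<in> unit_lists \<Longrightarrow> \<bar>form_apply T vs\<bar> \<le> B"
    for B and T :: "'a multiform"
    unfolding norm_multiform.rep_eq using that by (intro cSUP_least) (use unit_lists_Nil in blast, auto)
  have nonneg: "0 \<le> norm T" for T :: "'a multiform"
    using bound[of "[]" T] by simp
  have le: "norm (c *\<^sub>R T) \<le> \<bar>c\<bar> * norm T" for c and T :: "'a multiform"
    by (rule least) (simp add: scaleR_multiform.rep_eq abs_mult bound mult_left_mono)
  show "S + T + R = S + (T + R)" "S + T = T + S" "0 + S = S"
    by (transfer; simp add: add_ac)+
  show "- S + S = 0"
    unfolding uminus_multiform_def by transfer simp
  show "S - T = S + - T" by (rule minus_multiform_def)
  show "a *\<^sub>R (S + T) = a *\<^sub>R S + a *\<^sub>R T" "(a + b) *\<^sub>R S = a *\<^sub>R S + b *\<^sub>R S"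
       "a *\<^sub>R b *\<^sub>R S = (a * b) *\<^sub>R S" "1 *\<^sub>R S = S"
    by (transfer; simp add: algebra_simps)+
  show "dist S T = norm (S - T)" by (rule dist_multiform_def)
  show "sgn S = inverse (norm S) *\<^sub>R S" by (rule sgn_multiform_def)
  show "(uniformity :: ('a multiform \<times> 'a multiform) filter)
      = (INF e\<in>{0<..}. principal {(S, T). dist S T < e})"
    by (rule uniformity_multiform_def)
  show "open U = (\<forall>S\<in>U. \<forall>\<^sub>F (S', T) in uniformity. S' = S \<longrightarrow> T \<in> U)"
    for U :: "'a multiform set" by (rule open_multiform_def)
  show "norm S = 0 \<longleftrightarrow> S = 0"
  proof
    assume "norm S = 0"
    then have "form_apply S = (\<lambda>_. 0)"
      using form_apply[of S] bound[of _ S] by (intro multilinear_eq_0) auto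
    then show "S = 0" by transfer
  next
    assume "S = 0"
    then have "norm S \<le> 0" by (intro least) (simp add: zero_multiform.rep_eq)
    with nonneg[of S] show "norm S = 0" by simp
  qed
  show "norm (S + T) \<le> norm S + norm T"
  proof (rule least)
    fix vs :: "'a list" assume "vs \<in> unit_lists"
    with bound[of vs S] bound[of vs T]
    show "\<bar>form_apply (S + T) vs\<bar> \<le> norm S + norm T"
      by (simp add: plus_multiform.rep_eq)
  qed
  show "norm (a *\<^sub>R S) = \<bar>a\<bar> * norm S"
  proof (cases "a = 0")
    case True
    with le[of a S] nonneg[of "a *\<^sub>R S"] show ?thesis by simp
  next
    case False
    have "S = inverse a *\<^sub>R a *\<^sub>R S"
      using False by transfer (simp add: fun_eq_iff)
    with le[of "inverse a" "a *\<^sub>R S"] have "norm S \<le> \<bar>inverse a\<bar> * norm (a *\<^sub>R S)"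
      by simp
    with False have "\<bar>a\<bar> * norm S \<le> norm (a *\<^sub>R S)"
      by (simp add: field_simps abs_inverse)
    with le[of a S] show ?thesis by simp
  qed
qed

end


lemma form_apply_plus: "form_apply (S + T) vs = form_apply S vs + form_apply T vs"
  by (simp add: plus_multiform.rep_eq)

lemma form_apply_scaleR: "form_apply (c *\<^sub>R T) vs = c * form_apply T vs"
  by (simp add: scaleR_multiform.rep_eq)

lemma form_apply_zero: "form_apply 0 vs = 0"
  by (simp add: zero_multiform.rep_eq)

lemma form_apply_le_norm:
  assumes "vs \<in> unit_lists"
  shows "\<bar>form_apply T vs\<bar> \<le> norm T"
proof -
  have "\<exists>B. \<forall>vs\<in>unit_lists. \<bar>form_apply T vs\<bar> \<le> B"
    using form_apply[of T] by auto
  then have "bdd_above ((\<lambda>vs. \<bar>form_apply T vs\<bar>) ` unit_lists)"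
    by (auto intro: bdd_aboveI2)
  then show ?thesis unfolding norm_multiform.rep_eq using assms by (intro cSUP_upper)
qed

lemma bounded_linear_form_apply: "bounded_linear (\<lambda>T. form_apply T vs)"
proof (rule bounded_linear_intro[where K = "prod_list (map norm vs)"])
  fix T :: "'a multiform"
  have nonneg: "0 \<le> prod_list (map norm vs)"
    by (induction vs) auto
  have "\<bar>form_apply T vs\<bar> = prod_list (map norm vs) * \<bar>form_apply T (map sgn vs)\<bar>"
    using multilinear_normalize[of "form_apply T" "[]" vs] form_apply[of T]
    by (simp add: abs_mult nonneg)
  also have "\<dots> \<le> prod_list (map norm vs) * norm T"
    by (intro mult_left_mono form_apply_le_norm map_sgn_unit_lists nonneg)
  finally show "norm (form_apply T vs) \<le> norm T * prod_list (map norm vs)"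
    by (simp add: mult.commute)
qed (simp_all add: form_apply_plus form_apply_scaleR)


section \<open>Higher derivatives\<close>

definition const_form :: "real \<Rightarrow> 'a::real_normed_vector multiform" where
  "const_form c = Multiform (\<lambda>vs. case vs of [] \<Rightarrow> c | _ # _ \<Rightarrow> 0)"

text \<open>
  The identification of a linear map \<open>L\<close> into the \<open>k\<close>-linear forms with a \<open>(k+1)\<close>-linear form,
  \<open>(v, v1, \<dots>, vk) \<mapsto> L v (v1, \<dots>, vk)\<close>.
\<close>

definition uncurry_form :: "('a::real_normed_vector \<Rightarrow> 'a multiform) \<Rightarrow> 'a multiform" where
  "uncurry_form L = Multiform (\<lambda>vs. case vs of [] \<Rightarrow> 0 | v # ws \<Rightarrow> form_apply (L v) ws)"

text \<open>
  \<open>nderiv f k x\<close> is the \<open>k\<close>-th derivative of \<open>f\<close> at \<open>x\<close>, a \<open>k\<close>-linear form. It is meaningful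
  only if \<open>diff_at f k x\<close> holds, see below.
\<close>

primrec nderiv :: "('a::real_normed_vector \<Rightarrow> real) \<Rightarrow> nat \<Rightarrow> 'a \<Rightarrow> 'a multiform" where
  "nderiv f 0 = (\<lambda>x. const_form (f x))"
| "nderiv f (Suc k) = (\<lambda>x. uncurry_form (frechet_derivative (nderiv f k) (at x)))"

text \<open>
  \<open>diff_at f k x\<close> says that \<open>f\<close> is \<open>D\<^sup>k\<close> at \<open>x\<close>. The recursion starts from the void condition for
  \<open>k = 0\<close>; the case \<open>k = 1\<close> is Frechet differentiability (lemma \<open>diff_at_1\<close>).
\<close>

primrec diff_at :: "('a::real_normed_vector \<Rightarrow> real) \<Rightarrow> nat \<Rightarrow> 'a \<Rightarrow> bool" where
  "diff_at f 0 = (\<lambda>x. True)"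
| "diff_at f (Suc k) = (\<lambda>x. (\<forall>\<^sub>F y in nhds x. diff_at f k y) \<and> nderiv f k differentiable (at x))"

lemma form_apply_const_form:
  "form_apply (const_form c :: 'a::real_normed_vector multiform) vs = (case vs of [] \<Rightarrow> c | _ # _ \<Rightarrow> 0)"
proof -
  have *: "(case us @ v # ws of [] \<Rightarrow> c | _ # _ \<Rightarrow> 0) = 0" for us ws and v :: 'a
    by (cases us) auto
  have "multilinear (\<lambda>vs :: 'a list. case vs of [] \<Rightarrow> c | _ # _ \<Rightarrow> 0)"
    unfolding multilinear_def * by (simp add: linear_zero)
  then show ?thesis
    unfolding const_form_def
    by (subst Multiform_inverse) (auto intro!: exI[of _ "\<bar>c\<bar>"] split: list.split)
qed

lemma form_apply_uncurry_form:
  assumes "bounded_linear L"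
  shows "form_apply (uncurry_form L) vs = (case vs of [] \<Rightarrow> 0 | v # ws \<Rightarrow> form_apply (L v) ws)"
proof -
  interpret L: bounded_linear L by (rule assms)
  let ?T = "\<lambda>vs. case vs of [] \<Rightarrow> 0 | v # ws \<Rightarrow> form_apply (L v) ws"
  have "multilinear ?T"
    unfolding multilinear_def
  proof (intro allI)
    fix us ws :: "'a list"
    show "linear (\<lambda>v. ?T (us @ v # ws))"
    proof (cases us)
      case Nil
      then show ?thesis
        by (auto intro!: linearI simp: L.add L.scaleR form_apply_plus form_apply_scaleR)
    next
      case (Cons u us')
      then show ?thesis
        using form_apply[of "L u"] by (simp add: multilinear_def)
    qed
  qed
  moreover obtain K where K: "\<And>v. norm (L v) \<le> norm v * K" "0 \<le> K"
    using L.nonneg_bounded by blast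
  have "\<bar>?T vs\<bar> \<le> K" if "vs \<in> unit_lists" for vs
  proof (cases vs)
    case (Cons v ws)
    with that have v: "norm v \<le> 1" and "ws \<in> unit_lists"
      by (auto simp: unit_lists_def)
    then have "\<bar>form_apply (L v) ws\<bar> \<le> norm v * K"
      using form_apply_le_norm[of ws "L v"] K(1)[of v] by linarith
    also have "\<dots> \<le> K"
      using v K(2) by (simp add: mult_left_le_one_le)
    finally show ?thesis by (simp add: Cons)
  qed (simp add: K)
  ultimately show ?thesis
    unfolding uncurry_form_def by (subst Multiform_inverse) auto
qed

lemma nderiv_0_apply: "form_apply (nderiv f 0 x) [] = f x"
  by (simp add: form_apply_const_form)

lemma nderiv_Suc_apply:
  assumes "nderiv f k differentiable (at x)"
  shows "form_apply (nderiv f (Suc k) x) (v # vs) =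
    form_apply (frechet_derivative (nderiv f k) (at x) v) vs"
proof -
  have "bounded_linear (frechet_derivative (nderiv f k) (at x))"
    using assms frechet_derivative_works has_derivative_bounded_linear by blast
  from form_apply_uncurry_form[OF this] show ?thesis by simp
qed

lemma bounded_linear_const_form: "bounded_linear const_form"
proof (rule bounded_linear_intro[where K = 1])
  fix c d r :: real
  show "const_form (c + d) = const_form c + (const_form d :: 'a multiform)"
    by (auto simp flip: form_apply_inject
        simp: fun_eq_iff form_apply_const_form form_apply_plus split: list.split)
  show "const_form (r *\<^sub>R c) = r *\<^sub>R (const_form c :: 'a multiform)"
    by (auto simp flip: form_apply_inject
        simp: fun_eq_iff form_apply_const_form form_apply_scaleR split: list.split)
  have "(SUP vs\<in>unit_lists. \<bar>form_apply (const_form c :: 'a multiform) vs\<bar>) \<le> \<bar>c\<bar>"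
    by (rule cSUP_least)
       (use unit_lists_Nil in blast, auto simp: form_apply_const_form split: list.split)
  then show "norm (const_form c :: 'a multiform) \<le> norm c * 1"
    by (simp add: norm_multiform.rep_eq)
qed

lemma diff_at_1:
  fixes f :: "'a::real_normed_vector \<Rightarrow> real"
  shows "diff_at f 1 x \<longleftrightarrow> f differentiable (at x)"
proof -
  have "f differentiable (at x)" if "(\<lambda>x. const_form (f x) :: 'a multiform) differentiable (at x)"
  proof -
    from that obtain D where "((\<lambda>x. const_form (f x) :: 'a multiform) has_derivative D) (at x)"
      by (auto simp: differentiable_def)
    from bounded_linear.has_derivative[OF bounded_linear_form_apply[of "[]"] this]
    show ?thesis by (auto simp: differentiable_def form_apply_const_form)
  qed
  moreover have "(\<lambda>x. const_form (f x) :: 'a multiform) differentiable (at x)" if "f differentiable (at x)"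
    using that bounded_linear.has_derivative[OF bounded_linear_const_form]
    unfolding differentiable_def by blast
  ultimately show ?thesis by auto
qed

text \<open>
  The norm used for derivatives is the supremum over the diagonal, not the operator norm of
  \<^typ>\<open>'a multiform\<close>. It is \<^typ>\<open>ereal\<close>-valued only because \<open>indicator_inf\<close> is added to it; if
  \<open>'a\<close> has nonzero vectors, it is a finite number in \<open>[0, norm (nderiv f k x)]\<close>.
\<close>

definition nderiv_norm :: "('a::real_normed_vector \<Rightarrow> real) \<Rightarrow> nat \<Rightarrow> 'a \<Rightarrow> ereal" where
  "nderiv_norm f k x = (SUP v\<in>sphere 0 1. ereal \<bar>form_apply (nderiv f k x) (replicate k v)\<bar>)"


section \<open>Level sets, local minima and flatness\<close>

definition level_set :: "('a \<Rightarrow> real) \<Rightarrow> real \<Rightarrow> 'a set" where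
  "level_set f \<alpha> = {x. f x = \<alpha>}"

definition indicator_inf :: "'a set \<Rightarrow> 'a \<Rightarrow> ereal" where
  "indicator_inf S x = (if x \<in> S then 0 else \<infinity>)"

definition is_local_min :: "('a::topological_space \<Rightarrow> ereal) \<Rightarrow> 'a \<Rightarrow> bool" where
  "is_local_min g x \<longleftrightarrow> (\<forall>\<^sub>F y in nhds x. g x \<le> g y)"

definition is_strict_local_min :: "('a::topological_space \<Rightarrow> ereal) \<Rightarrow> 'a \<Rightarrow> bool" where
  "is_strict_local_min g x \<longleftrightarrow> (\<forall>\<^sub>F y in at x. g x < g y)"

definition osc :: "('a::metric_space \<Rightarrow> real) \<Rightarrow> 'a \<Rightarrow> real \<Rightarrow> ereal" where
  "osc f x r = (SUP y\<in>cball x r. ereal \<bar>f y - f x\<bar>)"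

definition flatter_eq :: "('a::metric_space \<Rightarrow> real) \<Rightarrow> 'a \<Rightarrow> 'a \<Rightarrow> bool" where
  "flatter_eq f x y \<longleftrightarrow> (\<exists>R>0. \<forall>r\<in>{0<..R}. osc f x r \<le> osc f y r)"

definition flatter :: "('a::metric_space \<Rightarrow> real) \<Rightarrow> 'a \<Rightarrow> 'a \<Rightarrow> bool" where
  "flatter f x y \<longleftrightarrow> flatter_eq f x y \<and> \<not> flatter_eq f y x"

definition flat_point :: "('a::metric_space \<Rightarrow> real) \<Rightarrow> 'a \<Rightarrow> bool" where
  "flat_point f x \<longleftrightarrow> (\<forall>\<^sub>F y in at x within level_set f (f x). flatter_eq f x y)"

definition strictly_flat_point :: "('a::metric_space \<Rightarrow> real) \<Rightarrow> 'a \<Rightarrow> bool" where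
  "strictly_flat_point f x \<longleftrightarrow> (\<forall>\<^sub>F y in at x within level_set f (f x). flatter f x y)"

end

theory Submission
  imports Defs
begin

text \<open>
  At a point \<open>x\<close> where the derivatives of order \<open>1, \<dots>, k - 1\<close> vanish, Taylor's formula with
  Peano remainder gives \<open>f (x + h) - f x = f\<^sup>(\<^sup>k\<^sup>)(x)(h, \<dots>, h) / k! + o(|h|\<^sup>k)\<close>, so the oscillation
  of \<open>f\<close> on the ball of radius \<open>r\<close> is \<open>\<parallel>f\<^sup>(\<^sup>k\<^sup>)(x)\<parallel> r\<^sup>k / k! + o(r\<^sup>k)\<close>. On the level set, a strict
  inequality between the norms of two \<open>k\<close>-th derivatives therefore forces the same strict
  inequality between the oscillations at all small radii; both claims follow.
\<close>

section \<open>Diagonal values of multilinear forms\<close>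

lemma form_apply_replicate_scaleR:
  "form_apply T (replicate m (c *\<^sub>R v)) = c ^ m * form_apply T (replicate m v)"
proof -
  \<comment> \<open>The prefix \<open>us\<close> takes in the arguments whose factor
    \<open>c\<close> is already pulled out; the induction hypothesis is used at
    \<open>us @ [v]\<close>.\<close>
  have "form_apply T (us @ replicate m (c *\<^sub>R v)) = c ^ m * form_apply T (us @ replicate m v)" for us
  proof (induction m arbitrary: us)
    case (Suc m)
    have "linear (\<lambda>w. form_apply T (us @ w # replicate m (c *\<^sub>R v)))"
      using form_apply[of T] by (simp add: multilinear_def)
    from linear_scale[OF this, of c v] Suc.IH[of "us @ [v]"] show ?case
      by simp
  qed simp
  from this[of "[]"] show ?thesis by simp
qed

lemma abs_form_apply_replicate_le:
  "\<bar>form_apply T (replicate m v)\<bar> \<le> norm T * norm v ^ m"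
proof -
  have "\<bar>form_apply T (replicate m v)\<bar> = norm v ^ m * \<bar>form_apply T (map sgn (replicate m v))\<bar>"
    using multilinear_normalize[of "form_apply T" "[]" "replicate m v"] form_apply[of T]
    by (simp add: abs_mult prod_list_replicate)
  also have "\<dots> \<le> norm v ^ m * norm T"
    by (intro mult_left_mono form_apply_le_norm map_sgn_unit_lists) simp
  finally show ?thesis by (simp add: mult.commute)
qed

section \<open>Taylor expansion along a segment\<close>

lemma diff_at_mono:
  assumes "diff_at f k x" "m \<le> k"
  shows "diff_at f m x"
  using assms(2,1)
proof (induction k rule: dec_induct)
  case (step n)
  then show ?case by (auto dest: eventually_nhds_x_imp_x)
qed

lemma nderiv_differentiable:
  assumes "diff_at f k x" "m < k"
  shows "nderiv f m differentiable (at x)"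
  using diff_at_mono[OF assms(1), of "Suc m"] assms(2) by simp

text \<open>Chain rule: \<open>uncurry_form\<close> takes the direction of differentiation as first
  argument, so differentiating a diagonal value along \<open>h\<close> gives the diagonal value one
  degree higher. This reduces the expansion to one real variable.\<close>

lemma has_derivative_nderiv_line:
  assumes "nderiv f m differentiable (at (x + t *\<^sub>R h))"
  shows "((\<lambda>t. form_apply (nderiv f m (x + t *\<^sub>R h)) (replicate m h)) has_real_derivative
      form_apply (nderiv f (Suc m) (x + t *\<^sub>R h)) (replicate (Suc m) h)) (at t)"
proof -
  define D where "D = frechet_derivative (nderiv f m) (at (x + t *\<^sub>R h))"
  have D: "(nderiv f m has_derivative D) (at (x + t *\<^sub>R h))"
    using assms frechet_derivative_works unfolding D_def by blast
  have "((\<lambda>t. x + t *\<^sub>R h) has_derivative (\<lambda>s. s *\<^sub>R h)) (at t)"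
    by (auto intro!: derivative_eq_intros)
  from has_derivative_compose[OF this D]
  have "((\<lambda>t. form_apply (nderiv f m (x + t *\<^sub>R h)) (replicate m h)) has_derivative
      (\<lambda>s. form_apply (D (s *\<^sub>R h)) (replicate m h))) (at t)"
    by (rule bounded_linear.has_derivative[OF bounded_linear_form_apply])
  moreover have "form_apply (D (s *\<^sub>R h)) (replicate m h) =
      form_apply (nderiv f (Suc m) (x + t *\<^sub>R h)) (replicate (Suc m) h) * s" for s
    using nderiv_Suc_apply[OF assms, of h "replicate m h"]
      linear_scale[OF has_derivative_linear[OF D], of s h]
    by (simp add: D_def form_apply_scaleR mult.commute)
  ultimately show ?thesis
    unfolding has_field_derivative_def by simp
qed

text \<open>The derivative of order \<open>k\<close> may exist at \<open>x\<close> alone, so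
  Lagrange's remainder is taken at order \<open>k - 1\<close>; the last order comes from Frechet
  differentiability of \<open>nderiv f (k - 1)\<close> at \<open>x\<close>.\<close>

lemma taylor_peano_first_nonvanishing:
  fixes f :: "'a::real_normed_vector \<Rightarrow> real"
  assumes k: "k \<ge> 1" and diff: "diff_at f k x"
    and vanish: "\<forall>i\<in>{1..k - 1}. nderiv f i x = 0" and "e > 0"
  shows "\<forall>\<^sub>F h in nhds 0.
    \<bar>f (x + h) - f x - form_apply (nderiv f k x) (replicate k h) / fact k\<bar> \<le> e * norm h ^ k"
proof -
  obtain n where n: "k = Suc n" using k by (cases k) auto
  define D where "D = frechet_derivative (nderiv f n) (at x)"
  have dn: "nderiv f n differentiable (at x)"
    using diff by (simp add: n)
  then have D: "(nderiv f n has_derivative D) (at x)"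
    using frechet_derivative_works unfolding D_def by blast
  obtain r1 where r1: "r1 > 0" "\<And>y. dist y x < r1 \<Longrightarrow> diff_at f n y"
    using diff unfolding n by (auto simp: eventually_nhds_metric)
  obtain r2 where r2: "r2 > 0" "\<And>y. norm (y - x) < r2 \<Longrightarrow>
      norm (nderiv f n y - nderiv f n x - D (y - x)) \<le> e * norm (y - x)"
    using D \<open>e > 0\<close> unfolding has_derivative_at_alt by blast
  have "\<bar>f (x + h) - f x - form_apply (nderiv f k x) (replicate k h) / fact k\<bar> \<le> e * norm h ^ k"
    if h: "norm h < min r1 r2" for h
  proof -
    define A where "A = form_apply (nderiv f k x) (replicate k h)"
    \<comment> \<open>\<open>\<psi> 0\<close> is the Taylor remainder along the segment, and
      \<open>\<psi> m\<close> is its \<open>m\<close>-th derivative for \<open>m \<le> n\<close>.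
      The subtracted \<open>nderiv f m x\<close> removes \<open>f x\<close> at \<open>m = 0\<close>
      and is zero for \<open>0 < m < k\<close>.\<close>
    define \<psi> where "\<psi> m t = form_apply (nderiv f m (x + t *\<^sub>R h) - nderiv f m x) (replicate m h)
        - A * t ^ (k - m) / fact (k - m)" for m t
    have apply_minus: "form_apply (S - T) vs = form_apply S vs - form_apply T vs"
      for S T :: "'a multiform" and vs
      by (rule linear_diff[OF bounded_linear.linear[OF bounded_linear_form_apply]])
    have th: "norm (t *\<^sub>R h) \<le> norm h" if "0 \<le> t" "t \<le> 1" for t
      using that by (simp add: mult_left_le_one_le)
    have deriv: "(\<psi> m has_real_derivative \<psi> (Suc m) t) (at t)" if m: "m < n" and "0 \<le> t" "t \<le> 1" for m t
    proof -
      have "dist (x + t *\<^sub>R h) x < r1"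
        using th[OF that(2,3)] h by (simp add: dist_norm)
      then have "nderiv f m differentiable (at (x + t *\<^sub>R h))"
        using nderiv_differentiable r1(2) that(1) by blast
      from has_derivative_nderiv_line[OF this]
      have d1: "((\<lambda>t. form_apply (nderiv f m (x + t *\<^sub>R h) - nderiv f m x) (replicate m h))
          has_real_derivative
          form_apply (nderiv f (Suc m) (x + t *\<^sub>R h)) (replicate (Suc m) h)) (at t)"
        unfolding apply_minus by (auto intro!: derivative_eq_intros)
      obtain j where j: "k - m = Suc j" "k - Suc m = j"
        using m n by (cases "k - m") auto
      have d2: "((\<lambda>t. A * t ^ Suc j / fact (Suc j)) has_real_derivative A * t ^ j / fact j) (at t)"
        by (rule derivative_eq_intros refl | simp)+
      have "nderiv f (Suc m) x = 0"
        using vanish m n by (auto simp del: nderiv.simps)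
      then show ?thesis
        using DERIV_diff[OF d1 d2] unfolding \<psi>_def j by (simp del: nderiv.simps add: apply_minus form_apply_zero)
    qed
    have \<psi>_0: "\<psi> m 0 = 0" if "m < k" for m
      using that by (simp add: \<psi>_def form_apply_zero)
    \<comment> \<open>\<open>Maclaurin\<close> needs positive order; for \<open>n = 0\<close> the
      choice \<open>t = 1\<close> is trivial, hence \<open>t \<le> 1\<close> instead of
      \<open>t < 1\<close>.\<close>
    obtain t where t: "0 < t" "t \<le> 1" "\<psi> 0 1 = \<psi> n t / fact n"
    proof (cases "n = 0")
      case True
      then show ?thesis using that[of 1] by simp
    next
      case False
      from Maclaurin[of 1 n \<psi> "\<psi> 0"] False deriv obtain t where
        t: "0 < t" "t < 1" "\<psi> 0 1 = (\<Sum>m<n. \<psi> m 0 / fact m * 1 ^ m) + \<psi> n t / fact n * 1 ^ n"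
        by auto
      moreover have "(\<Sum>m<n. \<psi> m 0 / fact m * 1 ^ m) = 0"
        using \<psi>_0 n by (intro sum.neutral) auto
      ultimately show ?thesis using that[of t] by simp
    qed
    \<comment> \<open>As \<open>k - n = 1\<close>, the polynomial term of \<open>\<psi> n t\<close>
      is \<open>A * t\<close>, the value of \<open>D\<close> at \<open>t h\<close> on the arguments
      \<open>h\<close>. Thus \<open>\<psi> n t\<close> is the first-order remainder of
      \<open>nderiv f n\<close>, bounded through \<open>r2\<close>.\<close>
    have "D (t *\<^sub>R h) = t *\<^sub>R D h"
      by (rule linear_scale[OF has_derivative_linear[OF D]])
    moreover have "form_apply (D h) (replicate n h) = A"
      using nderiv_Suc_apply[OF dn, of h "replicate n h"]
      by (simp add: A_def n D_def del: nderiv.simps)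
    ultimately have "\<psi> n t = form_apply (nderiv f n (x + t *\<^sub>R h) - nderiv f n x - D (t *\<^sub>R h))
        (replicate n h)"
      by (simp add: \<psi>_def n apply_minus form_apply_scaleR mult.commute del: nderiv.simps)
    also have "\<bar>\<dots>\<bar> \<le> norm (nderiv f n (x + t *\<^sub>R h) - nderiv f n x - D (t *\<^sub>R h)) * norm h ^ n"
      by (rule abs_form_apply_replicate_le)
    also have "\<dots> \<le> (e * norm h) * norm h ^ n"
    proof (rule mult_right_mono)
      have "norm (nderiv f n (x + t *\<^sub>R h) - nderiv f n x - D (t *\<^sub>R h)) \<le> e * norm (t *\<^sub>R h)"
        using r2(2)[of "x + t *\<^sub>R h"] th[of t] t h by simp
      also have "\<dots> \<le> e * norm h"
        using th[of t] t \<open>e > 0\<close> by (intro mult_left_mono) auto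
      finally show "norm (nderiv f n (x + t *\<^sub>R h) - nderiv f n x - D (t *\<^sub>R h)) \<le> e * norm h" .
    qed simp
    finally have "\<bar>\<psi> n t\<bar> \<le> e * norm h ^ k"
      by (simp add: n mult.assoc)
    moreover have "\<bar>\<psi> n t / fact n\<bar> \<le> \<bar>\<psi> n t\<bar>"
      using divide_left_mono[of 1 "fact n" "\<bar>\<psi> n t\<bar>"] by (simp add: abs_divide)
    moreover have "\<psi> 0 1 = f (x + h) - f x - A / fact k"
      by (simp add: \<psi>_def apply_minus form_apply_const_form)
    ultimately show ?thesis
      using t(3) unfolding A_def by linarith
  qed
  then show ?thesis
    unfolding eventually_nhds_metric
    using r1(1) r2(1) by (intro exI[of _ "min r1 r2"]) simp
qed

section \<open>Comparison of oscillations\<close>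

text \<open>The expansion bounds the oscillation at \<open>x\<close> from above on the whole ball,
  and the one at \<open>y\<close> from below along a single direction \<open>v\<close>. The supremum
  at \<open>y\<close> need not be attained: \<open>v\<close> only has to beat the norm at
  \<open>x\<close>.\<close>

lemma osc_less_of_nderiv_norm_less:
  fixes f :: "'a::real_normed_vector \<Rightarrow> real"
  assumes k: "k \<ge> 1"
    and x: "diff_at f k x" "\<forall>i\<in>{1..k - 1}. nderiv f i x = 0"
    and y: "diff_at f k y" "\<forall>i\<in>{1..k - 1}. nderiv f i y = 0"
    and less: "nderiv_norm f k x < nderiv_norm f k y"
  shows "\<exists>R>0. \<forall>r\<in>{0<..R}. osc f x r < osc f y r"
proof -
  obtain v where v: "norm v = 1"
    and vy: "nderiv_norm f k x < ereal \<bar>form_apply (nderiv f k y) (replicate k v)\<bar>"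
    using less unfolding nderiv_norm_def[of f k y] less_SUP_iff by auto
  have upper: "ereal \<bar>form_apply (nderiv f k x) (replicate k u)\<bar> \<le> nderiv_norm f k x"
    if "norm u = 1" for u
    unfolding nderiv_norm_def using that by (intro SUP_upper) auto
  define b where "b = \<bar>form_apply (nderiv f k y) (replicate k v)\<bar>"
  \<comment> \<open>The norm at \<open>x\<close> is finite: \<open>vy\<close> excludes the value
    infinity, \<open>upper\<close> the value minus infinity.\<close>
  obtain a where a: "nderiv_norm f k x = ereal a"
    using vy upper[OF v] by (cases "nderiv_norm f k x") auto
  have "a < b" using vy a by (simp add: b_def)
  have "0 \<le> a"
    using upper[OF v] abs_ge_zero order_trans unfolding a ereal_less_eq by blast
  \<comment> \<open>Homogeneity of degree \<open>k\<close> carries the bound from the unit sphere to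
    all \<open>h\<close>; \<open>h = 0\<close> is separate, as \<open>sgn 0\<close> is not a unit
    vector.\<close>
  have xle: "\<bar>form_apply (nderiv f k x) (replicate k h)\<bar> \<le> a * norm h ^ k" for h
  proof (cases "h = 0")
    case True
    then show ?thesis
      using form_apply_replicate_scaleR[of "nderiv f k x" k 0 h] k by (simp add: power_0_left)
  next
    case False
    then have "\<bar>form_apply (nderiv f k x) (replicate k (sgn h))\<bar> \<le> a"
      using upper[of "sgn h"] by (simp add: a norm_sgn)
    moreover have "h = norm h *\<^sub>R sgn h"
      using False by (simp add: sgn_div_norm)
    then have "form_apply (nderiv f k x) (replicate k h) =
        norm h ^ k * form_apply (nderiv f k x) (replicate k (sgn h))"
      by (metis form_apply_replicate_scaleR)
    ultimately show ?thesis
      by (simp add: abs_mult mult.commute[of a] mult_left_mono)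
  qed
  \<comment> \<open>A third of the gap between \<open>a / fact k\<close> and
    \<open>b / fact k\<close>: an error \<open>e\<close> on each side still leaves a margin
    \<open>e\<close>.\<close>
  define e where "e = (b - a) / (3 * fact k)"
  have "e > 0" using \<open>a < b\<close> by (simp add: e_def)
  have gap: "a / fact k + e < b / fact k - e"
    using \<open>a < b\<close> by (simp add: e_def field_simps)
  from eventually_conj[OF taylor_peano_first_nonvanishing[OF k x \<open>e > 0\<close>]
      taylor_peano_first_nonvanishing[OF k y \<open>e > 0\<close>]]
  obtain d where "d > 0" and d: "\<And>h. norm h < d \<Longrightarrow>
      \<bar>f (x + h) - f x - form_apply (nderiv f k x) (replicate k h) / fact k\<bar> \<le> e * norm h ^ k"
      "\<And>h. norm h < d \<Longrightarrow>
      \<bar>f (y + h) - f y - form_apply (nderiv f k y) (replicate k h) / fact k\<bar> \<le> e * norm h ^ k"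
    unfolding eventually_nhds_metric by auto
  \<comment> \<open>Halving \<open>d\<close> keeps the closed balls of radius \<open>r\<close>
    inside the open balls where the expansions hold.\<close>
  have "osc f x r < osc f y r" if r: "0 < r" "r \<le> d / 2" for r
  proof -
    have "r < d" using r \<open>d > 0\<close> by simp
    have "osc f x r \<le> ereal ((a / fact k + e) * r ^ k)"
      unfolding osc_def
    proof (rule SUP_least)
      fix z assume "z \<in> cball x r"
      define h where "h = z - x"
      have h: "norm h \<le> r" "z = x + h"
        using \<open>z \<in> cball x r\<close> by (auto simp: h_def dist_norm norm_minus_commute)
      have "\<bar>f z - f x\<bar> \<le> \<bar>form_apply (nderiv f k x) (replicate k h) / fact k\<bar> + e * norm h ^ k"
        using d(1)[of h] h(1) \<open>r < d\<close> unfolding h(2) by linarith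
      also have "\<dots> \<le> a * norm h ^ k / fact k + e * norm h ^ k"
        using xle[of h] by (simp add: abs_divide divide_right_mono)
      also have "\<dots> = (a / fact k + e) * norm h ^ k"
        by (simp add: algebra_simps)
      also have "\<dots> \<le> (a / fact k + e) * r ^ k"
        using h \<open>0 \<le> a\<close> \<open>e > 0\<close> by (intro mult_left_mono power_mono) auto
      finally show "ereal \<bar>f z - f x\<bar> \<le> ereal ((a / fact k + e) * r ^ k)"
        by simp
    qed
    also have "\<dots> < ereal ((b / fact k - e) * r ^ k)"
      using gap r by simp
    also have "\<dots> \<le> ereal \<bar>f (y + r *\<^sub>R v) - f y\<bar>"
    proof -
      have norm: "norm (r *\<^sub>R v) = r" using v r by simp
      have "\<bar>form_apply (nderiv f k y) (replicate k (r *\<^sub>R v)) / fact k\<bar> = b / fact k * r ^ k"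
        using r by (simp add: form_apply_replicate_scaleR b_def abs_mult abs_divide)
      then have "b / fact k * r ^ k - e * r ^ k \<le> \<bar>f (y + r *\<^sub>R v) - f y\<bar>"
        using d(2)[of "r *\<^sub>R v"] \<open>r < d\<close> unfolding norm by linarith
      then show ?thesis by (simp add: left_diff_distrib)
    qed
    also have "\<dots> \<le> osc f y r"
      unfolding osc_def using v r by (intro SUP_upper) (simp add: dist_norm)
    finally show ?thesis .
  qed
  then show ?thesis
    using \<open>d > 0\<close> by (intro exI[of _ "d / 2"]) auto
qed

text \<open>The reverse comparison, valid up to some \<open>S\<close>, would contradict the strict
  one at the common radius \<open>min R S\<close>.\<close>

lemma flatter_of_osc_less:
  assumes "\<exists>R>0. \<forall>r\<in>{0<..R}. osc f x r < osc f y r"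
  shows "flatter f x y"
proof -
  obtain R where R: "R > 0" "\<And>r. 0 < r \<Longrightarrow> r \<le> R \<Longrightarrow> osc f x r < osc f y r"
    using assms by auto
  have "\<not> flatter_eq f y x"
  proof
    assume "flatter_eq f y x"
    then obtain S where S: "S > 0" "\<And>r. 0 < r \<Longrightarrow> r \<le> S \<Longrightarrow> osc f y r \<le> osc f x r"
      unfolding flatter_eq_def by auto
    show False
      using R(2)[of "min R S"] S(2)[of "min R S"] R(1) S(1) by simp
  qed
  moreover have "flatter_eq f x y"
    unfolding flatter_eq_def using R by (intro exI[of _ R]) (auto intro: less_imp_le)
  ultimately show ?thesis
    by (simp add: flatter_def)
qed

section \<open>Flatness and local minima on the level set\<close>

theorem corollary3p19:
  fixes f :: "real ^ 'n \<Rightarrow> real" and xbar :: "real ^ 'n" and k :: nat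
  assumes "k \<ge> 1"
    and "\<forall>\<^sub>F x in nhds xbar. diff_at f k x"
    and "\<forall>\<^sub>F x in nhds xbar. x \<in> level_set f (f xbar) \<longrightarrow> (\<forall>i\<in>{1..k - 1}. nderiv f i x = 0)"
  shows "(flat_point f xbar \<longrightarrow>
           is_local_min (\<lambda>x. nderiv_norm f k x + indicator_inf (level_set f (f xbar)) x) xbar)
       \<and> (is_strict_local_min (\<lambda>x. nderiv_norm f k x + indicator_inf (level_set f (f xbar)) x) xbar \<longrightarrow>
           strictly_flat_point f xbar)"
proof -
  define L where "L = level_set f (f xbar)"
  define P where "P y \<longleftrightarrow> diff_at f k y \<and> (\<forall>i\<in>{1..k - 1}. nderiv f i y = 0)" for y
  have "xbar \<in> L" by (simp add: L_def level_set_def)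
  have P: "\<forall>\<^sub>F y in nhds xbar. y \<in> L \<longrightarrow> P y"
    using assms(2,3) by eventually_elim (auto simp: P_def L_def)
  then have "P xbar"
    using \<open>xbar \<in> L\<close> eventually_nhds_x_imp_x by fastforce
  have flatter: "flatter f y z" if "P y" "P z" "nderiv_norm f k y < nderiv_norm f k z" for y z
    using that \<open>k \<ge> 1\<close> unfolding P_def
    by (intro flatter_of_osc_less osc_less_of_nderiv_norm_less[where k = k]) auto
  have "is_local_min (\<lambda>x. nderiv_norm f k x + indicator_inf L x) xbar" if "flat_point f xbar"
  proof -
    have "\<forall>\<^sub>F y in nhds xbar. y \<noteq> xbar \<longrightarrow> y \<in> L \<longrightarrow> flatter_eq f xbar y"
      using that unfolding flat_point_def eventually_at_filter L_def .
    with P have "\<forall>\<^sub>F y in nhds xbar. nderiv_norm f k xbar + indicator_inf L xbar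
        \<le> nderiv_norm f k y + indicator_inf L y"
    proof eventually_elim
      case (elim y)
      \<comment> \<open>Otherwise \<open>y\<close> would be strictly flatter than
        \<open>xbar\<close>, against \<open>flatter_eq f xbar y\<close>.\<close>
      have "nderiv_norm f k xbar \<le> nderiv_norm f k y" if "y \<in> L" "y \<noteq> xbar"
        using flatter[of y xbar] elim that \<open>P xbar\<close> unfolding flatter_def by force
      then show ?case
        using \<open>xbar \<in> L\<close> by (cases "y = xbar") (auto simp: indicator_inf_def)
    qed
    then show ?thesis by (simp add: is_local_min_def)
  qed
  moreover have "strictly_flat_point f xbar"
    if "is_strict_local_min (\<lambda>x. nderiv_norm f k x + indicator_inf L x) xbar"
  proof -
    have "\<forall>\<^sub>F y in nhds xbar. y \<noteq> xbar \<longrightarrow>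
        nderiv_norm f k xbar + indicator_inf L xbar < nderiv_norm f k y + indicator_inf L y"
      using that by (simp add: is_strict_local_min_def eventually_at_filter)
    \<comment> \<open>On \<open>L\<close> both indicators are \<open>0\<close>, so the strict
      minimum compares the norms themselves.\<close>
    with P have "\<forall>\<^sub>F y in nhds xbar. y \<noteq> xbar \<longrightarrow> y \<in> L \<longrightarrow> flatter f xbar y"
      by eventually_elim
        (use \<open>P xbar\<close> \<open>xbar \<in> L\<close> flatter in \<open>auto simp: indicator_inf_def\<close>)
    then show ?thesis
      unfolding strictly_flat_point_def eventually_at_filter L_def .
  qed
  ultimately show ?thesis
    unfolding L_def by blast
qed

end
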